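(* Let $\mathbf{s}=(s_1,\ldots,s_N)$ with $s_k\in F$ for every $k=1,\ldots,N$, and suppose that, for every $i=1,\ldots,N$, the neighbor set $B_i$ contains every index $k\neq i$ for which $\Omega_i\cap\Omega_k$ has positive area. Then, for any $i=1,\ldots,N$, the objective function $H(\mathbf{s})=\int_F R(x)P(x,\mathbf{s})\,dx$ can be written as $$H(\mathbf{s})=H_i(\mathbf{s})+\tilde H(\bar{\mathbf{s}}_i),$$ where $\bar{\mathbf{s}}_i=(s_1,\ldots,s_{i-1},s_{i+1},\ldots,s_N)$ and $$H_i(\mathbf{s})=\int_{V(s_i)}R(x)\,\Phi_i(x)\,p_i(x,s_i)\,dx,$$ $$\tilde H(\bar{\mathbf{s}}_i)=\int_F R(x)\Big\{1-\prod_{k=1,\,k\neq i}^{N}\big[1-\hat p_k(x,s_k)\big]\Big\}\,dx.$$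
   Context: The mission space $\Omega\subset\mathbb{R}^2$ is a non-self-intersecting polygon (the region it encloses). It may contain obstacles $M_1,\ldots,M_m$, each a non-self-intersecting polygon with interior $\mathring{M}_j$. The feasible space is $F=\Omega\setminus(\mathring{M}_1\cup\cdots\cup\mathring{M}_m)$. The event density $R:\Omega\to\mathbb{R}$ satisfies $R(x)\ge 0$ for all $x\in\Omega$, $\int_\Omega R(x)\,dx<\infty$, and $R(x)=0$ for $x\notin F$. There are $N$ sensor nodes with positions $s_1,\ldots,s_N\in F$ and sensing radii $\delta_1,\ldots,\delta_N>0$. For node $i$, put $d_i(x)=\|x-s_i\|$ (Euclidean norm); its sensing region is $\Omega_i=\{x: d_i(x)\le\delta_i\}$. The visibility set of node $i$ is $$V(s_i)=\Omega_i\cap\{x\in F:\ \lambda x+(1-\lambda)s_i\in F\ \text{for all }\lambda\in[0,1]\},$$ and the invisibility set is $\bar V(s_i)=F\setminus V(s_i)$. For $x\in V(s_i)$, $p_i(x,s_i)\in[0,1]$ is the probability that node $i$ detects an event at $x$; it is a function of $d_i(x)$, monotonically decreasing and differentiable in $d_i(x)$. The sensing detection probability is $$\hat p_i(x,s_i)=\begin{cases}p_i(x,s_i)& \text{if } x\in V(s_i),\\ 0&\text{if } x\in\bar V(s_i).\end{cases}$$ The joint detection probability is $P(x,\mathbf{s})=1-\prod_{i=1}^N[1-\hat p_i(x,s_i)]$. The neighbor set of node $i$ is $B_i=\{k:\ \|s_i-s_k\|<2\delta_i,\ k=1,\ldots,N,\ k\ne i\}$, and $$\Phi_i(x)=\prod_{k\in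 B_i}[1-\hat p_k(x,s_k)]$$ (an empty product equals $1$) is the probability that $x$ is not detected by any neighbor of $i$. *)

theory Defs
  imports "HOL-Analysis.Analysis"
begin

fun polygonal_path :: "(real^2) list \<Rightarrow> real \<Rightarrow> real^2" where
  "polygonal_path [] = linepath 0 0"
| "polygonal_path [a] = linepath a a"
| "polygonal_path [a, b] = linepath a b"
| "polygonal_path (a # b # c # vs) = linepath a b +++ polygonal_path (b # c # vs)"

text \<open>
  A polygon is the closed region enclosed by a closed polygonal path (the first vertex is
  repeated at the end of the vertex list) that does not intersect itself. Since
  \<^const>\<open>simple_path\<close> allows only the two endpoints to coincide, degenerate vertex lists
  (fewer than three distinct vertices) are excluded.
\<close>

definition simple_polygon :: "(real^2) set \<Rightarrow> bool" where
  "simple_polygon S \<longleftrightarrow>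
     (\<exists>vs. simple_path (polygonal_path vs) \<and>
           pathfinish (polygonal_path vs) = pathstart (polygonal_path vs) \<and>
           S = path_image (polygonal_path vs) \<union> inside (path_image (polygonal_path vs)))"

definition feasible_space ::
    "(real^2) set \<Rightarrow> nat \<Rightarrow> (nat \<Rightarrow> (real^2) set) \<Rightarrow> (real^2) set" where
  "feasible_space \<Omega> m M = \<Omega> - (\<Union>j\<in>{1..m}. interior (M j))"

definition sensing_region :: "real \<Rightarrow> real^2 \<Rightarrow> (real^2) set" where
  "sensing_region r y = {x. norm (x - y) \<le> r}"

definition visibility_set :: "(real^2) set \<Rightarrow> real \<Rightarrow> real^2 \<Rightarrow> (real^2) set" where
  "visibility_set F r y =
     sensing_region r y \<inter> {x \<in> F. \<forall>u\<in>{0..1}. u *\<^sub>R x + (1 - u) *\<^sub>R y \<in> F}"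

text \<open>
  The function \<open>p x y\<close> is the detection probability at \<open>x\<close> of a node with sensing radius \<open>r\<close>
  located at \<open>y\<close>; it is constrained only for \<open>x\<close> in the visibility set of \<open>y\<close>. The profile
  \<open>q\<close> gives it as a function of the distance, which ranges over \<open>{0..r}\<close>.
\<close>

definition sensing_model ::
    "(real^2) set \<Rightarrow> real \<Rightarrow> (real^2 \<Rightarrow> real^2 \<Rightarrow> real) \<Rightarrow> bool" where
  "sensing_model F r p \<longleftrightarrow>
     (\<forall>y\<in>F. \<forall>x\<in>visibility_set F r y. 0 \<le> p x y \<and> p x y \<le> 1) \<and>
     (\<exists>q. antimono_on {0..r} q \<and> q differentiable_on {0..r} \<and>
          (\<forall>y\<in>F. \<forall>x\<in>visibility_set F r y. p x y = q (norm (x - y))))"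

definition detection_prob ::
    "(real^2) set \<Rightarrow> real \<Rightarrow> (real^2 \<Rightarrow> real^2 \<Rightarrow> real) \<Rightarrow> real^2 \<Rightarrow> real^2 \<Rightarrow> real" where
  "detection_prob F r p x y = (if x \<in> visibility_set F r y then p x y else 0)"

definition joint_detection_prob ::
    "nat \<Rightarrow> (real^2) set \<Rightarrow> (nat \<Rightarrow> real) \<Rightarrow> (nat \<Rightarrow> real^2 \<Rightarrow> real^2 \<Rightarrow> real) \<Rightarrow>
     real^2 \<Rightarrow> (nat \<Rightarrow> real^2) \<Rightarrow> real" where
  "joint_detection_prob N F \<delta> p x s =
     1 - (\<Prod>i\<in>{1..N}. 1 - detection_prob F (\<delta> i) (p i) x (s i))"

definition neighbors :: "nat \<Rightarrow> (nat \<Rightarrow> real) \<Rightarrow> (nat \<Rightarrow> real^2) \<Rightarrow> nat \<Rightarrow> nat set" where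
  "neighbors N \<delta> s i = {k \<in> {1..N}. norm (s i - s k) < 2 * \<delta> i \<and> k \<noteq> i}"

definition neighbors_miss_prob ::
    "nat \<Rightarrow> (real^2) set \<Rightarrow> (nat \<Rightarrow> real) \<Rightarrow> (nat \<Rightarrow> real^2 \<Rightarrow> real^2 \<Rightarrow> real) \<Rightarrow>
     (nat \<Rightarrow> real^2) \<Rightarrow> nat \<Rightarrow> real^2 \<Rightarrow> real" where
  "neighbors_miss_prob N F \<delta> p s i x =
     (\<Prod>k\<in>neighbors N \<delta> s i. 1 - detection_prob F (\<delta> k) (p k) x (s k))"

definition objective ::
    "nat \<Rightarrow> (real^2) set \<Rightarrow> (real^2 \<Rightarrow> real) \<Rightarrow> (nat \<Rightarrow> real) \<Rightarrow>
     (nat \<Rightarrow> real^2 \<Rightarrow> real^2 \<Rightarrow> real) \<Rightarrow> (nat \<Rightarrow> real^2) \<Rightarrow> real" where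
  "objective N F R \<delta> p s = (LINT x:F|lebesgue. R x * joint_detection_prob N F \<delta> p x s)"

definition local_objective ::
    "nat \<Rightarrow> (real^2) set \<Rightarrow> (real^2 \<Rightarrow> real) \<Rightarrow> (nat \<Rightarrow> real) \<Rightarrow>
     (nat \<Rightarrow> real^2 \<Rightarrow> real^2 \<Rightarrow> real) \<Rightarrow> nat \<Rightarrow> (nat \<Rightarrow> real^2) \<Rightarrow> real" where
  "local_objective N F R \<delta> p i s =
     (LINT x:visibility_set F (\<delta> i) (s i)|lebesgue.
        R x * neighbors_miss_prob N F \<delta> p s i x * p i x (s i))"

definition others :: "nat \<Rightarrow> nat \<Rightarrow> (nat \<Rightarrow> real^2) \<Rightarrow> nat \<Rightarrow> real^2" where
  "others N i s = restrict s ({1..N} - {i})"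

definition remaining_objective ::
    "nat \<Rightarrow> (real^2) set \<Rightarrow> (real^2 \<Rightarrow> real) \<Rightarrow> (nat \<Rightarrow> real) \<Rightarrow>
     (nat \<Rightarrow> real^2 \<Rightarrow> real^2 \<Rightarrow> real) \<Rightarrow> nat \<Rightarrow> (nat \<Rightarrow> real^2) \<Rightarrow> real" where
  "remaining_objective N F R \<delta> p i t =
     (LINT x:F|lebesgue.
        R x * (1 - (\<Prod>k\<in>{1..N} - {i}. 1 - detection_prob F (\<delta> k) (p k) x (t k))))"

end

theory Submission
  imports Defs
begin

text \<open>
  With \<open>p\<^sub>k\<close> extended by \<open>0\<close> off the visibility set of \<open>k\<close>, pointwise
  \<open>P = (1 - \<Prod>\<^bsub>k \<noteq> i\<^esub> (1 - p\<^sub>k)) + p\<^sub>i \<Prod>\<^bsub>k \<noteq> i\<^esub> (1 - p\<^sub>k)\<close>. A node \<open>k \<noteq> i\<close> outside the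
  neighbor set of \<open>i\<close> has a sensing region meeting that of \<open>i\<close> in a null set, so it contributes
  the factor \<open>1\<close> almost everywhere on the visibility set of \<open>i\<close>. Splitting the integral requires
  integrability, which holds because all detection probabilities are bounded and, the
  visibility sets being closed, measurable.
\<close>

lemma closed_simple_polygon:
  assumes "simple_polygon S"
  shows "closed S"
proof -
  obtain vs where vs: "simple_path (polygonal_path vs)"
    "S = path_image (polygonal_path vs) \<union> inside (path_image (polygonal_path vs))"
    using assms unfolding simple_polygon_def by blast
  then show ?thesis
    using closed_path_image_Un_inside simple_path_imp_path by blast
qed

lemma closed_feasible_space:
  assumes "closed \<Omega>"
  shows "closed (feasible_space \<Omega> m M)"
  unfolding feasible_space_def using assms by (intro closed_Diff open_UN) auto

lemma sensing_region_eq_cball: "sensing_region r y = cball y r"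
  by (auto simp: sensing_region_def dist_norm norm_minus_commute)

text \<open>For each fixed \<open>u\<close> the condition on \<open>x\<close> is the preimage of
  \<open>F\<close> under a continuous affine map, so the set is an intersection of closed
  sets.\<close>

lemma closed_visibility_set:
  assumes "closed F"
  shows "closed (visibility_set F r y)"
proof -
  have "closed ((\<lambda>x. u *\<^sub>R x + (1 - u) *\<^sub>R y) -` F)" for u :: real
    by (intro closed_vimage assms continuous_intros)
  then have "closed (cball y r \<inter> F \<inter> (\<Inter>u\<in>{0..1}. (\<lambda>x. u *\<^sub>R x + (1 - u) *\<^sub>R y) -` F))"
    using assms by auto
  moreover have "visibility_set F r y =
      cball y r \<inter> F \<inter> (\<Inter>u\<in>{0..1}. (\<lambda>x. u *\<^sub>R x + (1 - u) *\<^sub>R y) -` F)"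
    by (auto simp: visibility_set_def sensing_region_eq_cball)
  ultimately show ?thesis by simp
qed

lemma detection_prob_in_unit_interval:
  assumes "sensing_model F r p" and "y \<in> F"
  shows "detection_prob F r p x y \<in> {0..1}"
  using assms unfolding sensing_model_def detection_prob_def by auto

text \<open>On the visibility set the distance stays in \<open>{0..r}\<close>, where the
  differentiable profile \<open>q\<close> is continuous. Hence \<open>p\<close> is continuous on a
  closed set, and its extension by 0 is Borel, even if it jumps at the boundary.\<close>

lemma borel_measurable_detection_prob:
  assumes "closed F" and "sensing_model F r p" and "y \<in> F"
  shows "(\<lambda>x. detection_prob F r p x y) \<in> borel_measurable borel"
proof -
  let ?V = "visibility_set F r y"
  obtain q where q: "q differentiable_on {0..r}"
    and p: "\<forall>x\<in>?V. p x y = q (norm (x - y))"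
    using assms(2,3) unfolding sensing_model_def by blast
  have "continuous_on ?V (\<lambda>x. q (norm (x - y)))"
    by (rule continuous_on_compose2[OF differentiable_imp_continuous_on[OF q]])
       (auto intro!: continuous_intros simp: visibility_set_def sensing_region_def)
  then have "continuous_on ?V (\<lambda>x. p x y)"
    using p continuous_on_cong by fastforce
  then have "(\<lambda>x. if x \<in> ?V then p x y else 0) \<in> borel_measurable borel"
    by (intro borel_measurable_continuous_on_if borel_closed closed_visibility_set assms(1))
       auto
  then show ?thesis by (simp add: detection_prob_def)
qed

text \<open>The product is dominated by \<open>R\<close> itself, so only measurability of
  \<open>g\<close> has to be checked.\<close>

lemma set_integrable_mult_unit_interval:
  fixes R g :: "'a \<Rightarrow> real"
  assumes "set_integrable M A R" and "g \<in> borel_measurable M" and "\<And>x. g x \<in> {0..1}"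
  shows "set_integrable M A (\<lambda>x. R x * g x)"
proof -
  let ?R = "\<lambda>x. indicator A x *\<^sub>R R x"
  have R: "integrable M ?R" using assms(1) by (simp add: set_integrable_def)
  have "integrable M (\<lambda>x. ?R x * g x)"
  proof (rule Bochner_Integration.integrable_bound[OF R])
    show "(\<lambda>x. ?R x * g x) \<in> borel_measurable M"
      by (rule borel_measurable_times[OF borel_measurable_integrable[OF R] assms(2)])
    show "AE x in M. norm (?R x * g x) \<le> norm (?R x)"
    proof (rule AE_I2)
      fix x
      show "norm (?R x * g x) \<le> norm (?R x)"
        using assms(3)[of x] by (simp add: abs_mult mult_left_le)
    qed
  qed
  then show ?thesis by (simp add: set_integrable_def mult.assoc)
qed

text \<open>Since \<open>measure\<close> is also 0 on sets of infinite measure, its vanishing alone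
  does not give a null set; compactness of the intersection of two discs closes this gap.\<close>

lemma null_sensing_region_Int:
  assumes "\<not> measure lebesgue (sensing_region r y \<inter> sensing_region r' y') > 0"
  shows "AE x in lebesgue. x \<notin> sensing_region r y \<inter> sensing_region r' y'"
proof -
  let ?C = "sensing_region r y \<inter> sensing_region r' y'"
  have "?C \<in> lmeasurable"
    by (auto simp: sensing_region_eq_cball intro!: lmeasurable_compact compact_Int_closed)
  moreover have "measure lebesgue ?C = 0"
    using assms measure_nonneg[of lebesgue ?C] by linarith
  ultimately have "?C \<in> null_sets lebesgue"
    by (simp add: negligible_iff_null_sets[symmetric] negligible_iff_measure)
  then show ?thesis by (rule AE_not_in)
qed

lemma AE_neighbors_miss_prob:
  assumes "\<And>k. \<lbrakk>k \<in> {1..N}; k \<noteq> i;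
      measure lebesgue (sensing_region (\<delta> i) (s i) \<inter> sensing_region (\<delta> k) (s k)) > 0\<rbrakk>
      \<Longrightarrow> k \<in> neighbors N \<delta> s i"
  shows "AE x in lebesgue. x \<in> visibility_set F (\<delta> i) (s i) \<longrightarrow>
    neighbors_miss_prob N F \<delta> p s i x =
      (\<Prod>k\<in>{1..N} - {i}. 1 - detection_prob F (\<delta> k) (p k) x (s k))"
proof -
  \<comment> \<open>These are the factors missing from \<open>neighbors_miss_prob\<close>. There are
    finitely many, so their exceptional null sets can be combined.\<close>
  let ?D = "{1..N} - {i} - neighbors N \<delta> s i"
  have "AE x in lebesgue. \<forall>k\<in>?D. x \<notin> sensing_region (\<delta> i) (s i) \<inter> sensing_region (\<delta> k) (s k)"
  proof (rule AE_finite_allI)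
    fix k assume "k \<in> ?D"
    then show "AE x in lebesgue. x \<notin> sensing_region (\<delta> i) (s i) \<inter> sensing_region (\<delta> k) (s k)"
      using assms by (intro null_sensing_region_Int) blast
  qed simp
  then show ?thesis
  proof (rule AE_mp, intro AE_I2 impI)
    fix x
    assume *: "\<forall>k\<in>?D. x \<notin> sensing_region (\<delta> i) (s i) \<inter> sensing_region (\<delta> k) (s k)"
      and x: "x \<in> visibility_set F (\<delta> i) (s i)"
    have "detection_prob F (\<delta> k) (p k) x (s k) = 0" if "k \<in> ?D" for k
      using * x that by (auto simp: detection_prob_def visibility_set_def)
    moreover have "neighbors N \<delta> s i \<subseteq> {1..N} - {i}"
      by (auto simp: neighbors_def)
    ultimately show "neighbors_miss_prob N F \<delta> p s i x =
        (\<Prod>k\<in>{1..N} - {i}. 1 - detection_prob F (\<delta> k) (p k) x (s k))"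
      unfolding neighbors_miss_prob_def by (intro prod.mono_neutral_left) simp_all
  qed
qed

theorem theorem1:
  fixes \<Omega> :: "(real^2) set"
    and m :: nat and M :: "nat \<Rightarrow> (real^2) set"
    and R :: "real^2 \<Rightarrow> real"
    and N :: nat and \<delta> :: "nat \<Rightarrow> real"
    and p :: "nat \<Rightarrow> real^2 \<Rightarrow> real^2 \<Rightarrow> real"
    and s :: "nat \<Rightarrow> real^2" and i :: nat
  defines "F \<equiv> feasible_space \<Omega> m M"
  assumes "simple_polygon \<Omega>"
    and "\<And>j. j \<in> {1..m} \<Longrightarrow> simple_polygon (M j) \<and> M j \<subseteq> \<Omega>"
    and "\<And>x. x \<in> \<Omega> \<Longrightarrow> R x \<ge> 0"
    and "set_integrable lebesgue \<Omega> R"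
    and "\<And>x. x \<in> \<Omega> - F \<Longrightarrow> R x = 0"
    and "\<And>k. k \<in> {1..N} \<Longrightarrow> \<delta> k > 0"
    and "\<And>k. k \<in> {1..N} \<Longrightarrow> sensing_model F (\<delta> k) (p k)"
    and "\<And>k. k \<in> {1..N} \<Longrightarrow> s k \<in> F"
    and "\<And>j k. \<lbrakk>j \<in> {1..N}; k \<in> {1..N}; k \<noteq> j;
           measure lebesgue (sensing_region (\<delta> j) (s j) \<inter> sensing_region (\<delta> k) (s k)) > 0\<rbrakk>
           \<Longrightarrow> k \<in> neighbors N \<delta> s j"
    and "i \<in> {1..N}"
  shows "objective N F R \<delta> p s =
           local_objective N F R \<delta> p i s + remaining_objective N F R \<delta> p i (others N i s)"
proof -
  let ?d = "\<lambda>k x. detection_prob F (\<delta> k) (p k) x (s k)"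
  let ?V = "visibility_set F (\<delta> i) (s i)"
  \<comment> \<open>\<open>Q x\<close> is the probability that no node other than \<open>i\<close>
    detects \<open>x\<close>; it stands in for the product over neighbors on all of
    \<open>F\<close>.\<close>
  define Q where "Q x = (\<Prod>k\<in>{1..N} - {i}. 1 - ?d k x)" for x
  have cl\<Omega>: "closed \<Omega>" using assms(2) by (rule closed_simple_polygon)
  have clF: "closed F" unfolding F_def using cl\<Omega> by (rule closed_feasible_space)
  have VF: "?V \<subseteq> F" by (auto simp: visibility_set_def)
  have intF: "set_integrable lebesgue F R"
    by (rule set_integrable_subset[OF assms(5)])
       (use clF in \<open>auto simp: F_def feasible_space_def\<close>)
  have d01: "?d k x \<in> {0..1}" if "k \<in> {1..N}" for k x
    using that assms(8,9) by (intro detection_prob_in_unit_interval)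
  have meas_d: "?d k \<in> borel_measurable lebesgue" if "k \<in> {1..N}" for k
    using borel_measurable_detection_prob[OF clF assms(8,9)[OF that]]
    by (intro measurable_completion) simp
  have Q01: "Q x \<in> {0..1}" for x
    using d01 by (auto simp: Q_def intro!: prod_nonneg prod_le_1)
  have meas_Q: "Q \<in> borel_measurable lebesgue"
    unfolding Q_def using meas_d by (intro borel_measurable_prod) auto
  have int_rest: "set_integrable lebesgue F (\<lambda>x. R x * (1 - Q x))"
    using Q01 meas_Q by (intro set_integrable_mult_unit_interval intF) auto
  have int_i: "set_integrable lebesgue F (\<lambda>x. R x * (?d i x * Q x))"
    using Q01 d01[OF assms(11)] meas_Q meas_d[OF assms(11)]
    by (intro set_integrable_mult_unit_interval intF) (auto intro: mult_le_one)
  \<comment> \<open>Splitting off factor \<open>i\<close> turns the joint probability into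
    \<open>1 - (1 - d) * Q\<close>, with \<open>d\<close> the detection probability of node
    \<open>i\<close>.\<close>
  have joint: "joint_detection_prob N F \<delta> p x s = ?d i x * Q x + (1 - Q x)" for x
    unfolding joint_detection_prob_def Q_def using assms(11)
    by (subst prod.remove[of _ i]) (auto simp: algebra_simps)
  have Phi: "AE x in lebesgue. x \<in> ?V \<longrightarrow> neighbors_miss_prob N F \<delta> p s i x = Q x"
    unfolding Q_def using assms(10)[OF assms(11)] by (intro AE_neighbors_miss_prob) auto
  have local: "local_objective N F R \<delta> p i s = (LINT x:F|lebesgue. R x * (?d i x * Q x))"
  proof -
    have "set_integrable lebesgue ?V (\<lambda>x. R x * (?d i x * Q x))"
      by (rule set_integrable_subset[OF int_i])
         (use VF closed_visibility_set[OF clF] in auto)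
    then have meas: "(\<lambda>x. indicator ?V x *\<^sub>R (R x * (?d i x * Q x))) \<in> borel_measurable lebesgue"
      unfolding set_integrable_def by (rule borel_measurable_integrable)
    have "neighbors_miss_prob N F \<delta> p s i \<in> borel_measurable lebesgue"
      unfolding neighbors_miss_prob_def using meas_d
      by (intro borel_measurable_prod borel_measurable_diff) (auto simp: neighbors_def)
    moreover have "(\<lambda>x. indicator ?V x *\<^sub>R R x) \<in> borel_measurable lebesgue"
      using set_integrable_subset[OF intF _ VF] closed_visibility_set[OF clF]
      unfolding set_integrable_def by (intro borel_measurable_integrable) auto
    ultimately have "(\<lambda>x. (indicator ?V x *\<^sub>R R x) * neighbors_miss_prob N F \<delta> p s i x * ?d i x)
        \<in> borel_measurable lebesgue"
      using meas_d[OF assms(11)] by (intro borel_measurable_times)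
    \<comment> \<open>Nothing is known about \<open>p i\<close> off \<open>?V\<close>, so
      measurability is shown with \<open>?d i\<close> in its place; under the indicator the two
      agree.\<close>
    then have meas': "(\<lambda>x. indicator ?V x *\<^sub>R (R x * neighbors_miss_prob N F \<delta> p s i x * p i x (s i)))
        \<in> borel_measurable lebesgue"
      by (rule back_subst[of "\<lambda>f. f \<in> borel_measurable lebesgue"])
         (auto simp: fun_eq_iff detection_prob_def indicator_def)
    have ae: "AE x in lebesgue.
        indicator ?V x *\<^sub>R (R x * neighbors_miss_prob N F \<delta> p s i x * p i x (s i)) =
        indicator ?V x *\<^sub>R (R x * (?d i x * Q x))"
      using Phi by eventually_elim (auto simp: detection_prob_def indicator_def)
    have "local_objective N F R \<delta> p i s = (LINT x:?V|lebesgue. R x * (?d i x * Q x))"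
      unfolding local_objective_def set_lebesgue_integral_def
      by (rule integral_cong_AE[OF meas' meas ae])
    \<comment> \<open>The factor \<open>?d i\<close> vanishes on \<open>F - ?V\<close>, so enlarging
      the domain adds nothing.\<close>
    also have "\<dots> = (LINT x:F|lebesgue. R x * (?d i x * Q x))"
      unfolding set_lebesgue_integral_def using VF
      by (intro Bochner_Integration.integral_cong)
         (auto simp: detection_prob_def indicator_def)
    finally show ?thesis .
  qed
  \<comment> \<open>The product ranges only over indices where the restriction
    \<open>others N i s\<close> agrees with \<open>s\<close>, so its undefined values never
    enter.\<close>
  have "remaining_objective N F R \<delta> p i (others N i s) = (LINT x:F|lebesgue. R x * (1 - Q x))"
    by (simp add: remaining_objective_def Q_def others_def)
  moreover have "objective N F R \<delta> p s =
      (LINT x:F|lebesgue. R x * (?d i x * Q x) + R x * (1 - Q x))"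
    unfolding objective_def joint by (simp add: distrib_left)
  ultimately show ?thesis
    using local set_integral_add(2)[OF int_i int_rest] by simp
qed

end
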